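(* Let $X\subset\mathbb R^2$ be a locally connected Suslinian plane continuum. If $Y\subset X$ is a totally disconnected Borel set, then $\Lambda(Y)$ is countable.
   Context: A continuum is a compact connected metric space. A space is Suslinian if every collection of pairwise disjoint non-degenerate subcontinua of it is countable. A space $Y$ is totally disconnected if every two distinct points of $Y$ lie in disjoint clopen subsets of $Y$. $Y$ is zero-dimensional at $y\in Y$ if $y$ has a neighborhood basis in $Y$ consisting of clopen subsets of $Y$. $\Lambda(Y)$ denotes the set of points of $Y$ at which $Y$ is not zero-dimensional. *)

theory Defs
  imports "HOL-Analysis.Analysis"
begin

definition continuum :: "'a::metric_space set \<Rightarrow> bool" where
  "continuum C \<longleftrightarrow> C \<noteq> {} \<and> compact C \<and> connected C"

definition nondegenerate :: "'a set \<Rightarrow> bool" where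
  "nondegenerate C \<longleftrightarrow> (\<exists>a b. a \<in> C \<and> b \<in> C \<and> a \<noteq> b)"

definition suslinian :: "'a::metric_space set \<Rightarrow> bool" where
  "suslinian X \<longleftrightarrow>
     (\<forall>F. (\<forall>C\<in>F. C \<subseteq> X \<and> continuum C \<and> nondegenerate C) \<and> pairwise disjnt F
           \<longrightarrow> countable F)"

definition clopen_in :: "'a::topological_space set \<Rightarrow> 'a set \<Rightarrow> bool" where
  "clopen_in Y U \<longleftrightarrow> openin (top_of_set Y) U \<and> closedin (top_of_set Y) U"

definition totally_disconnected :: "'a::topological_space set \<Rightarrow> bool" where
  "totally_disconnected Y \<longleftrightarrow>
     (\<forall>x\<in>Y. \<forall>y\<in>Y. x \<noteq> y \<longrightarrow>
        (\<exists>U V. clopen_in Y U \<and> clopen_in Y V \<and> x \<in> U \<and> y \<in> V \<and> disjnt U V))"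

definition zero_dim_at :: "'a::topological_space set \<Rightarrow> 'a \<Rightarrow> bool" where
  "zero_dim_at Y y \<longleftrightarrow> y \<in> Y \<and>
     (\<forall>W. openin (top_of_set Y) W \<and> y \<in> W \<longrightarrow>
        (\<exists>U. clopen_in Y U \<and> y \<in> U \<and> U \<subseteq> W))"

definition Lambda :: "'a::topological_space set \<Rightarrow> 'a set" where
  "Lambda Y = {y \<in> Y. \<not> zero_dim_at Y y}"

end

theory Submission
  imports Defs
begin

text \<open>
  For \<open>x \<in> Y\<close> let \<open>Q(Y, x)\<close> be the intersection of the closures of all clopen neighbourhoods of \<open>x\<close>
  in \<open>Y\<close>. It is a continuum that meets \<open>Y\<close> only in \<open>x\<close>, and for \<open>x \<in> \<Lambda>(Y)\<close> and every open \<open>B \<ni> x\<close> even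
  \<open>Q(Y \<inter> B, x)\<close> is non-degenerate. By the Suslinian property, a maximal disjoint family of
  non-degenerate continua inside such sets \<open>Q(Y, x)\<close> is countable, and each \<open>Q(Y \<inter> B, x)\<close> meets one of
  its members. If \<open>\<Lambda>(Y)\<close> were uncountable, the pigeonhole principle would give three points \<open>x\<close>,
  neighbourhoods \<open>B3 \<subseteq> B2\<close> of all three, and disjoint continua \<open>L1\<close>, \<open>L2\<close>, \<open>L3\<close> such that \<open>L1\<close> meets
  each \<open>Q(Y, x)\<close>, \<open>L2\<close> meets each \<open>Q(Y \<inter> B2, x)\<close>, \<open>L3\<close> meets each \<open>Q(Y \<inter> B3, x)\<close>, while \<open>L1\<close> misses the
  closure of \<open>B2\<close> and \<open>L2\<close> that of \<open>B3\<close>. The three points lie in disjoint connected open sets whose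
  traces on \<open>Y\<close> are clopen, and these sets touch \<open>L1\<close>, \<open>L2\<close> and \<open>L3\<close>. This is a plane drawing of
  \<open>K\<^sub>3\<^sub>,\<^sub>3\<close>, which Janiszewski's theorem excludes.
\<close>

section \<open>Non-planarity of $K_{3,3}$ for connected sets\<close>

text \<open>The component of \<open>b\<close> off \<open>J3\<close> cannot meet \<open>T3\<close>,
  which off \<open>J3\<close> lies on the side of \<open>p\<close>; so it also avoids
  \<open>J1\<close>. By symmetry the components of \<open>b\<close> off \<open>J1\<close> and off
  \<open>J3\<close> coincide, and their frontier lies in \<open>J1 \<inter> J3 = F\<close>. As the
  complement of \<open>F\<close> is connected, this component fills it and contains
  \<open>p\<close>.\<close>

lemma no_common_component_of_two_theta_cycles:
  fixes F :: "complex set"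
  assumes cJ: "closed J3" "closed J1"
    and T3: "T3 - J3 \<subseteq> connected_component_set (- J3) p"
    and T1: "T1 - J1 \<subseteq> connected_component_set (- J1) p"
    and J: "J1 \<subseteq> J3 \<union> T3" "J3 \<subseteq> J1 \<union> T1"
    and F: "J1 \<inter> J3 = F" "connected (- F)"
    and p: "p \<notin> F"
    and b: "b \<notin> J3 \<union> J1" "\<not> connected_component (- J3) p b" "\<not> connected_component (- J1) p b"
  shows False
proof -
  define V where "V = connected_component_set (- J3) b"
  define W where "W = connected_component_set (- J1) b"
  have bV: "b \<in> V" and bW: "b \<in> W"
    using b by (auto simp: V_def W_def intro: connected_component_refl)
  have disjV: "V \<inter> connected_component_set (- J3) p = {}"
    unfolding V_def using b(2) by (metis connected_component_disjoint inf_commute mem_Collect_eq)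
  have disjW: "W \<inter> connected_component_set (- J1) p = {}"
    unfolding W_def using b(3) by (metis connected_component_disjoint inf_commute mem_Collect_eq)
  have VJ: "V \<subseteq> - J3" "W \<subseteq> - J1"
    by (simp_all add: V_def W_def connected_component_subset)
  have "V \<subseteq> - J1" "W \<subseteq> - J3"
    using VJ disjV disjW T3 T1 J by blast+
  then have "V \<subseteq> W" "W \<subseteq> V"
    using bV bW by (simp_all add: V_def W_def connected_component_maximal)
  then have VW: "V = W" by blast
  have "frontier V \<subseteq> J3"
    unfolding V_def using cJ(1)
    by (metis frontier_complement frontier_of_connected_component_subset frontier_subset_closed subset_trans)
  moreover have "frontier W \<subseteq> J1"
    unfolding W_def using cJ(2)
    by (metis frontier_complement frontier_of_connected_component_subset frontier_subset_closed subset_trans)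
  ultimately have "frontier V \<inter> - F = {}"
    using VW F by auto
  moreover have "- F \<inter> V \<noteq> {}"
    using bV b F by auto
  ultimately have "- F \<subseteq> V"
    using connected_Int_frontier[OF F(2), of V] by blast
  then have "p \<in> V" using p by auto
  then show False using disjV VJ by (metis (mono_tags) ComplD connected_component_refl disjoint_iff mem_Collect_eq subsetD ComplI)
qed

text \<open>Think of a theta graph with thick vertices \<open>N1\<close>, \<open>N2\<close> and
  edges \<open>T1\<close>, \<open>T2\<close>, \<open>T3\<close>. Each face is bounded by two edges
  only, and the third edge lies across that cycle, whereas \<open>acc\<close> puts \<open>p\<close>
  on the side of the remaining edge for every one of the three cycles.\<close>

lemma no_theta_touching_three_edges:
  fixes N1 N2 T1 T2 T3 :: "complex set"
  assumes cpt: "compact N1" "compact N2" "compact T1" "compact T2" "compact T3"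
    and conF: "connected (N1 \<union> N2 \<union> T1)" "connected (N1 \<union> N2 \<union> T2)" "connected (N1 \<union> N2 \<union> T3)"
    and N: "N1 \<inter> N2 = {}" "N1 \<noteq> {}" "N2 \<noteq> {}"
    and disj: "T1 \<inter> T2 = {}" "T1 \<inter> T3 = {}" "T2 \<inter> T3 = {}"
    and nonsep: "connected (- (N1 \<union> N2 \<union> T1))" "connected (- (N1 \<union> N2 \<union> T2))" "connected (- (N1 \<union> N2 \<union> T3))"
    and p: "p \<notin> N1 \<union> N2 \<union> T1 \<union> T2 \<union> T3"
    and acc: "T1 - (N1 \<union> N2) \<subseteq> connected_component_set (- (N1 \<union> N2 \<union> T2 \<union> T3)) p"
      "T2 - (N1 \<union> N2) \<subseteq> connected_component_set (- (N1 \<union> N2 \<union> T1 \<union> T3)) p"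
      "T3 - (N1 \<union> N2) \<subseteq> connected_component_set (- (N1 \<union> N2 \<union> T1 \<union> T2)) p"
  shows False
proof -
  define J1 J2 J3 where J_defs: "J1 = N1 \<union> N2 \<union> T2 \<union> T3" "J2 = N1 \<union> N2 \<union> T1 \<union> T3" "J3 = N1 \<union> N2 \<union> T1 \<union> T2"
  have cJ: "compact J1" "compact J2" "compact J3"
    using cpt by (auto simp: J_defs)
  have clJ: "closed J1" "closed J2" "closed J3"
    using cJ compact_imp_closed by auto
  have "\<not> connected (N1 \<union> N2)"
    using N cpt by (metis closed_Un compact_imp_closed connected_closed_set)
  moreover have "(N1 \<union> N2 \<union> T1) \<inter> (N1 \<union> N2 \<union> T2) = N1 \<union> N2"
    using disj by blast
  moreover have "(N1 \<union> N2 \<union> T1) \<union> (N1 \<union> N2 \<union> T2) = J3"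
    by (auto simp: J_defs)
  \<comment> \<open>Contrapositive of \<open>Janiszewski_dual\<close>: the union of two continua
    with disconnected intersection separates the plane.\<close>
  ultimately have "\<not> connected (- J3)"
    using Janiszewski_dual[of "N1 \<union> N2 \<union> T1" "N1 \<union> N2 \<union> T2"] cpt conF by auto
  then obtain u v where uv: "u \<notin> J3" "v \<notin> J3" "\<not> connected_component (- J3) u v"
    by (auto simp: connected_iff_connected_component)
  then have "\<not> connected_component (- J3) p u \<or> \<not> connected_component (- J3) p v"
    by (meson connected_component_sym connected_component_trans)
  with uv obtain b where b: "b \<notin> J3" "\<not> connected_component (- J3) p b"
    by blast
  have bT: "b \<notin> T3"
    using acc(3) b by (auto simp: J_defs)
  \<comment> \<open>If neither cycle separated the points, then, \<open>J1 \<inter> J2\<close> being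
    connected, Janiszewski's theorem would join \<open>p\<close> to \<open>b\<close> off
    \<open>J1 \<union> J2\<close>, which contains \<open>J3\<close>.\<close>
  have "\<not> connected_component (- J1) p b \<or> \<not> connected_component (- J2) p b"
  proof (rule ccontr)
    assume neg: "\<not> ?thesis"
    have "J1 \<inter> J2 = N1 \<union> N2 \<union> T3"
      using disj by (auto simp: J_defs)
    then have "connected_component (- (J1 \<union> J2)) p b"
      using Janiszewski[of J1 J2 p b] neg cJ clJ conF by auto
    then show False
      using b(2) by (elim notE) (erule connected_component_of_subset, auto simp: J_defs)
  qed
  then show False
  proof
    assume *: "\<not> connected_component (- J1) p b"
    show False
    proof (rule no_common_component_of_two_theta_cycles[of J3 J1 T3 p T1 "N1 \<union> N2 \<union> T2" b])
      show "J1 \<inter> J3 = N1 \<union> N2 \<union> T2" using disj by (auto simp: J_defs)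
    qed (use * clJ acc nonsep p b bT in \<open>auto simp: J_defs\<close>)
  next
    assume *: "\<not> connected_component (- J2) p b"
    show False
    proof (rule no_common_component_of_two_theta_cycles[of J3 J2 T3 p T2 "N1 \<union> N2 \<union> T1" b])
      show "J2 \<inter> J3 = N1 \<union> N2 \<union> T1" using disj by (auto simp: J_defs)
    qed (use * clJ acc nonsep p b bT in \<open>auto simp: J_defs\<close>)
  qed
qed

section \<open>Thick vertices: nonseparating continua and connected neighbourhoods\<close>

lemma path_first_hit:
  fixes g :: "real \<Rightarrow> 'a::metric_space"
  assumes "path g" "pathfinish g \<in> N" "closed N" "pathstart g \<notin> N"
  obtains t where "0 < t" "t \<le> 1" "g t \<in> N" "\<And>s. \<lbrakk>0 \<le> s; s < t\<rbrakk> \<Longrightarrow> g s \<notin> N"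
proof -
  obtain t where t: "0 \<le> t" "t \<le> 1" "\<And>s. 0 \<le> s \<and> s < t \<Longrightarrow> g s \<in> interior (- N)" "g t \<notin> interior (- N)"
    by (rule subpath_to_frontier_explicit[of g "- N"]) (use assms in auto)
  have int: "interior (- N) = - N"
    using assms(3) by (simp add: interior_open open_Compl)
  then have "t \<noteq> 0"
    using t(4) assms(4) by (auto simp: pathstart_def)
  then have "0 < t" using t(1) by simp
  moreover have "g t \<in> N" using t(4) int by simp
  moreover have "g s \<notin> N" if "0 \<le> s" "s < t" for s
    using t(3)[of s] that int by simp
  ultimately show ?thesis
    using t(2) that[of t] by blast
qed

text \<open>Induction on \<open>A\<close>: a new point is joined to \<open>K\<close> by an arc that
  meets \<open>K\<close> in its endpoint only, so \<open>Janiszewski_connected\<close> keeps the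
  complement connected. Such a \<open>K\<close> replaces a vertex when the graph is drawn.\<close>

lemma nonseparating_continuum_through_finite_set:
  fixes M :: "complex set"
  assumes "open M" "connected M" "finite A" "A \<subseteq> M" "A \<noteq> {}"
  shows "\<exists>K. compact K \<and> connected K \<and> connected (- K) \<and> A \<subseteq> K \<and> K \<subseteq> M"
  using assms(3,5,4)
proof (induction rule: finite_ne_induct)
  case (singleton a)
  have "connected (- {a})"
    by (simp add: connected_punctured_universe)
  with singleton show ?case
    by (intro exI[of _ "{a}"]) auto
next
  case (insert a A)
  then obtain K where K: "compact K" "connected K" "connected (- K)" "A \<subseteq> K" "K \<subseteq> M"
    by auto
  show ?case
  proof (cases "a \<in> K")
    case True
    then show ?thesis using K by blast
  next
    case False
    obtain c where c: "c \<in> K" using insert K by blast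
    have "path_connected M"
      using assms(1,2) by (simp add: connected_open_path_connected)
    then obtain g where g: "path g" "path_image g \<subseteq> M" "pathstart g = a" "pathfinish g = c"
      using c K insert.prems unfolding path_connected_def by (metis insert_subset subsetD)
    obtain t where t: "0 < t" "t \<le> 1" "g t \<in> K" "\<And>s. \<lbrakk>0 \<le> s; s < t\<rbrakk> \<Longrightarrow> g s \<notin> K"
      using path_first_hit[of g K] g c False K(1) compact_imp_closed by metis
    have img: "path_image (subpath 0 t g) = g ` {0..t}"
      using t by (simp add: path_image_subpath)
    have "g ` {0..t} \<subseteq> M"
      using g(2) t by (force simp: path_image_def)
    \<comment> \<open>An arc is extracted because, unlike the image of a general path, it never
      separates the plane.\<close>
    obtain h where h: "arc h" "path_image h \<subseteq> g ` {0..t}" "pathstart h = a" "pathfinish h = g t"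
      using path_contains_arc[of "subpath 0 t g" a "g t"] img t g False
      by (metis path_subpath atLeastAtMost_iff less_eq_real_def pathstart_subpath pathfinish_subpath pathstart_def zero_le_one)
    have "K \<inter> g ` {0..t} \<subseteq> {g t}"
    proof clarsimp
      fix s assume s: "g s \<in> K" "0 \<le> s" "s \<le> t"
      then have "\<not> s < t" using t(4) by blast
      then show "g s = g t" using s by simp
    qed
    then have Kh: "K \<inter> path_image h = {g t}"
      using h t pathfinish_in_path_image[of h] by auto
    show ?thesis
    proof (intro exI conjI)
      show "compact (K \<union> path_image h)"
        using K h by (simp add: compact_Un compact_arc_image)
      show "connected (K \<union> path_image h)"
        using K h Kh by (intro connected_Un) (auto simp: connected_arc_image)
      show "connected (- (K \<union> path_image h))"
        using K h Kh by (intro Janiszewski_connected) (auto simp: closed_arc_image connected_arc_complement)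
      show "insert a A \<subseteq> K \<union> path_image h"
        using K h pathstart_in_path_image[of h] by auto
      show "K \<union> path_image h \<subseteq> M"
        using K h \<open>g ` {0..t} \<subseteq> M\<close> by auto
    qed
  qed
qed

lemma connected_open_neighbourhood_avoiding_closed:
  fixes L :: "'a::real_normed_vector set"
  assumes "connected L" "closed C" "L \<inter> C = {}" "L \<noteq> {}"
  obtains M where "open M" "connected M" "L \<subseteq> M" "M \<inter> C = {}"
proof -
  obtain l where l: "l \<in> L" using assms by blast
  show ?thesis
  proof
    show "open (connected_component_set (- C) l)"
      using assms by (simp add: open_Compl open_connected_component)
    show "L \<subseteq> connected_component_set (- C) l"
      using assms l by (intro connected_component_maximal) auto
    show "connected_component_set (- C) l \<inter> C = {}"
      using connected_component_subset[of "- C" l] by blast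
  qed auto
qed

text \<open>The sets may be disjoint: a limit point \<open>q\<close> of \<open>D\<close> that lies
  in \<open>L\<close> can be added to \<open>D\<close> without losing connectedness.\<close>

lemma connected_Un_touching:
  assumes "connected D" "connected L" "closure D \<inter> L \<noteq> {}"
  shows "connected (D \<union> L)"
proof -
  obtain q where q: "q \<in> closure D" "q \<in> L" using assms by blast
  have "connected (insert q D)"
    using assms(1) by (rule connected_intermediate_closure) (use q closure_subset in auto)
  then have "connected (insert q D \<union> L)"
    using assms(2) q by (intro connected_Un) auto
  then show ?thesis
    using q by (metis Un_insert_left Un_insert_right insert_absorb)
qed

text \<open>The nesting of the three levels makes up for the possible inaccessibility of the contact
  points: the edges to \<open>L1\<close> are drawn first and the neighbourhood of \<open>L2\<close> is then chosen so small
  that it avoids them, while edges to \<open>L2\<close> stay away from \<open>L1\<close> since they run in \<open>D2\<close>.\<close>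

lemma planar_no_K33:
  fixes L1 L2 L3 :: "complex set" and D1 D2 D3 :: "'i \<Rightarrow> complex set"
  assumes I: "card I = 3"
    and L: "closed L1" "connected L1" "closed L2" "connected L2" "closed L3" "connected L3"
    and disjL: "L1 \<inter> L2 = {}" "L1 \<inter> L3 = {}" "L2 \<inter> L3 = {}"
    and D1: "\<And>i. i \<in> I \<Longrightarrow> open (D1 i)" "\<And>i. i \<in> I \<Longrightarrow> connected (D1 i)"
    and D2: "\<And>i. i \<in> I \<Longrightarrow> open (D2 i)" "\<And>i. i \<in> I \<Longrightarrow> connected (D2 i)" "\<And>i. i \<in> I \<Longrightarrow> D2 i \<subseteq> D1 i"
    and D3: "\<And>i. i \<in> I \<Longrightarrow> connected (D3 i)" "\<And>i. i \<in> I \<Longrightarrow> D3 i \<subseteq> D2 i"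
    and disjD: "\<And>i j. \<lbrakk>i \<in> I; j \<in> I; i \<noteq> j\<rbrakk> \<Longrightarrow> D1 i \<inter> D1 j = {}"
    and DL: "\<And>i. i \<in> I \<Longrightarrow> D1 i \<inter> (L1 \<union> L2 \<union> L3) = {}"
    and away: "\<And>i. i \<in> I \<Longrightarrow> closure (D2 i) \<inter> L1 = {}" "\<And>i. i \<in> I \<Longrightarrow> closure (D3 i) \<inter> L2 = {}"
    and touch: "\<And>i. i \<in> I \<Longrightarrow> closure (D1 i) \<inter> L1 \<noteq> {}" "\<And>i. i \<in> I \<Longrightarrow> closure (D2 i) \<inter> L2 \<noteq> {}"
      "\<And>i. i \<in> I \<Longrightarrow> closure (D3 i) \<inter> L3 \<noteq> {}"
  shows False
proof -
  have finI: "finite I" and neI: "I \<noteq> {}"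
    using I by (auto intro: card_ge_0_finite)
  have Lne: "L1 \<noteq> {}" "L2 \<noteq> {}" "L3 \<noteq> {}"
    using neI touch by auto
  \<comment> \<open>The vertex \<open>x i\<close> lies in all three nested sets: paths run from it
    inside \<open>D1 i\<close> to \<open>N1\<close> and inside \<open>D2 i\<close> to
    \<open>N2\<close>, and \<open>D3 i\<close> itself links it to \<open>L3\<close>.\<close>
  have "\<forall>i\<in>I. \<exists>x. x \<in> D3 i"
    using touch(3) by (metis closure_empty ex_in_conv inf_bot_left)
  then obtain x where x: "\<And>i. i \<in> I \<Longrightarrow> x i \<in> D3 i" by metis
  have xD: "x i \<in> D2 i" "x i \<in> D1 i" if "i \<in> I" for i
    using x[OF that] D3(2)[OF that] D2(3)[OF that] by auto

  \<comment> \<open>A path to \<open>L1\<close> may end anywhere in \<open>M1\<close>, so no point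
    of \<open>L1\<close> need be accessible from \<open>D1 i\<close>. Keeping \<open>M1\<close> off
    \<open>closure (D2 i)\<close> makes the later paths to \<open>L2\<close> miss
    \<open>N1\<close>.\<close>
  obtain M1 where M1: "open M1" "connected M1" "L1 \<subseteq> M1" "M1 \<inter> (L2 \<union> L3 \<union> (\<Union>i\<in>I. closure (D2 i))) = {}"
  proof (rule connected_open_neighbourhood_avoiding_closed[of L1 "L2 \<union> L3 \<union> (\<Union>i\<in>I. closure (D2 i))"])
    show "closed (L2 \<union> L3 \<union> (\<Union>i\<in>I. closure (D2 i)))"
      using L finI by (intro closed_Un closed_UN) auto
    show "L1 \<inter> (L2 \<union> L3 \<union> (\<Union>i\<in>I. closure (D2 i))) = {}"
      using disjL away(1) by blast
  qed (use L Lne in auto)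
  have "\<exists>a g. a \<in> M1 \<inter> D1 i \<and> path g \<and> path_image g \<subseteq> D1 i \<and> pathstart g = x i \<and> pathfinish g = a" if "i \<in> I" for i
  proof -
    have "M1 \<inter> D1 i \<noteq> {}"
      using touch(1)[OF that] M1 open_Int_closure_eq_empty[of M1 "D1 i"] by blast
    then obtain a where "a \<in> M1 \<inter> D1 i" by blast
    moreover have "path_connected (D1 i)"
      using D1 that by (simp add: connected_open_path_connected)
    ultimately show ?thesis
      using xD that unfolding path_connected_def by (metis IntD2)
  qed
  then obtain a g where ag: "\<And>i. i \<in> I \<Longrightarrow> a i \<in> M1 \<inter> D1 i" "\<And>i. i \<in> I \<Longrightarrow> path (g i)"
    "\<And>i. i \<in> I \<Longrightarrow> path_image (g i) \<subseteq> D1 i" "\<And>i. i \<in> I \<Longrightarrow> pathstart (g i) = x i" "\<And>i. i \<in> I \<Longrightarrow> pathfinish (g i) = a i"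
    by metis
  obtain N1 where N1: "compact N1" "connected N1" "connected (- N1)" "a ` I \<subseteq> N1" "N1 \<subseteq> M1"
    using nonseparating_continuum_through_finite_set[OF M1(1,2), of "a ` I"] finI neI ag(1) by blast

  \<comment> \<open>The paths \<open>g i\<close> are already fixed and form a closed set disjoint
    from \<open>L2\<close>; hence \<open>N2\<close> can be kept off them, off \<open>N1\<close> and
    off every \<open>D3 i\<close>.\<close>
  obtain M2 where M2: "open M2" "connected M2" "L2 \<subseteq> M2"
    "M2 \<inter> (L3 \<union> N1 \<union> (\<Union>i\<in>I. closure (D3 i)) \<union> (\<Union>i\<in>I. path_image (g i))) = {}"
  proof (rule connected_open_neighbourhood_avoiding_closed[of L2 "L3 \<union> N1 \<union> (\<Union>i\<in>I. closure (D3 i)) \<union> (\<Union>i\<in>I. path_image (g i))"])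
    show "closed (L3 \<union> N1 \<union> (\<Union>i\<in>I. closure (D3 i)) \<union> (\<Union>i\<in>I. path_image (g i)))"
      using L N1 finI ag(2) by (intro closed_Un closed_UN) (auto simp: compact_imp_closed closed_path_image)
    have "L2 \<inter> path_image (g i) = {}" if "i \<in> I" for i
      using ag(3)[OF that] DL[OF that] by blast
    then show "L2 \<inter> (L3 \<union> N1 \<union> (\<Union>i\<in>I. closure (D3 i)) \<union> (\<Union>i\<in>I. path_image (g i))) = {}"
      using disjL N1(5) M1(4) away(2) by blast
  qed (use L Lne in auto)
  have "\<exists>b h. b \<in> M2 \<inter> D2 i \<and> path h \<and> path_image h \<subseteq> D2 i \<and> pathstart h = x i \<and> pathfinish h = b" if "i \<in> I" for i
  proof -
    have "M2 \<inter> D2 i \<noteq> {}"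
      using touch(2)[OF that] M2 open_Int_closure_eq_empty[of M2 "D2 i"] by blast
    then obtain b where "b \<in> M2 \<inter> D2 i" by blast
    moreover have "path_connected (D2 i)"
      using D2 that by (simp add: connected_open_path_connected)
    ultimately show ?thesis
      using xD that unfolding path_connected_def by (metis IntD2)
  qed
  then obtain b h where bh: "\<And>i. i \<in> I \<Longrightarrow> b i \<in> M2 \<inter> D2 i" "\<And>i. i \<in> I \<Longrightarrow> path (h i)"
    "\<And>i. i \<in> I \<Longrightarrow> path_image (h i) \<subseteq> D2 i" "\<And>i. i \<in> I \<Longrightarrow> pathstart (h i) = x i" "\<And>i. i \<in> I \<Longrightarrow> pathfinish (h i) = b i"
    by metis
  obtain N2 where N2: "compact N2" "connected N2" "connected (- N2)" "b ` I \<subseteq> N2" "N2 \<subseteq> M2"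
    using nonseparating_continuum_through_finite_set[OF M2(1,2), of "b ` I"] finI neI bh(1) by blast
  have N12: "N1 \<inter> N2 = {}" using N2(5) M2(4) by blast
  have N1D: "N1 \<inter> D2 i = {}" if "i \<in> I" for i
    using N1(5) M1(4) closure_subset[of "D2 i"] that by blast
  have N2D: "N2 \<inter> D3 i = {}" "N2 \<inter> path_image (g i) = {}" if "i \<in> I" for i
    using N2(5) M2(4) closure_subset[of "D3 i"] that by blast+
  have xN: "x i \<notin> N1" "x i \<notin> N2" if "i \<in> I" for i
    using N1D[OF that] N2D[OF that] x[OF that] xD[OF that] by auto

  \<comment> \<open>Both paths from \<open>x i\<close> are cut at their first contacts with
    \<open>N1\<close> and \<open>N2\<close>, and \<open>T\<close> is an arc inside their union. It
    may bypass \<open>x i\<close>; the connected set \<open>E\<close>, made of the half-open pieces,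
    keeps the link from \<open>x i\<close> to the interior of \<open>T\<close>.\<close>
  have "\<forall>i\<in>I. \<exists>T. arc T \<and> path_image T \<subseteq> D1 i \<and> (\<exists>e. N1 \<inter> path_image T = {e}) \<and> (\<exists>f. N2 \<inter> path_image T = {f})
      \<and> (\<exists>E. connected E \<and> x i \<in> E \<and> E \<subseteq> D1 i - (N1 \<union> N2) \<and> path_image T - (N1 \<union> N2) \<subseteq> E)"
    (is "\<forall>i\<in>I. \<exists>T. ?Q i T")
  proof
    fix i assume i: "i \<in> I"
    obtain s where s: "0 < s" "s \<le> 1" "g i s \<in> N1" "\<And>r. \<lbrakk>0 \<le> r; r < s\<rbrakk> \<Longrightarrow> g i r \<notin> N1"
      using path_first_hit[of "g i" N1] ag[OF i] xN(1)[OF i] N1 i compact_imp_closed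
      by (metis image_subset_iff)
    obtain t where t: "0 < t" "t \<le> 1" "h i t \<in> N2" "\<And>r. \<lbrakk>0 \<le> r; r < t\<rbrakk> \<Longrightarrow> h i r \<notin> N2"
      using path_first_hit[of "h i" N2] bh[OF i] xN(2)[OF i] N2 i compact_imp_closed
      by (metis image_subset_iff)
    have g0: "g i 0 = x i" "h i 0 = x i"
      using ag(4)[OF i] bh(4)[OF i] by (auto simp: pathstart_def)
    define e f where "e = g i s" and "f = h i t"
    define E where "E = g i ` {0..<s} \<union> h i ` {0..<t}"
    have gimg: "g i ` {0..s} \<subseteq> path_image (g i)" and himg: "h i ` {0..t} \<subseteq> path_image (h i)"
      using s t by (auto simp: path_image_def)
    have ep: "g i ` {0..s} = insert e (g i ` {0..<s})" "h i ` {0..t} = insert f (h i ` {0..<t})"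
      using s t by (auto simp: e_def f_def less_le)
    have "e \<noteq> f" using s t N12 by (auto simp: e_def f_def)
    define P where "P = reversepath (subpath 0 s (g i)) +++ subpath 0 t (h i)"
    have "path P"
      using s t ag(2)[OF i] bh(2)[OF i] g0 by (auto simp: P_def intro!: path_subpath)
    moreover have "pathstart P = e" "pathfinish P = f"
      by (simp_all add: P_def e_def f_def)
    ultimately obtain T where T: "arc T" "path_image T \<subseteq> path_image P" "pathstart T = e" "pathfinish T = f"
      using path_contains_arc \<open>e \<noteq> f\<close> by metis
    have "path_image P = g i ` {0..s} \<union> h i ` {0..t}"
      using s t g0 by (simp add: P_def path_image_join path_image_subpath)
    then have TE: "path_image T \<subseteq> insert e (insert f E)"
      using T(2) ep by (auto simp: E_def)
    have sub: "g i ` {0..<s} \<subseteq> path_image (g i)" "h i ` {0..<t} \<subseteq> D2 i"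
      "e \<in> path_image (g i)" "f \<in> D2 i"
      using gimg order_trans[OF himg bh(3)[OF i]] unfolding ep by simp_all
    have "g i ` {0..<s} \<inter> N2 = {}" "h i ` {0..<t} \<inter> N1 = {}"
      using sub N2D(2)[OF i] N1D[OF i] by (metis disjoint_iff subsetD)+
    moreover have "g i ` {0..<s} \<inter> N1 = {}" "h i ` {0..<t} \<inter> N2 = {}"
      using s(4) t(4) by auto
    ultimately have EN: "E \<inter> (N1 \<union> N2) = {}"
      by (auto simp: E_def)
    have ED: "insert e (insert f E) \<subseteq> D1 i"
      using sub ag(3)[OF i] D2(3)[OF i] unfolding E_def
      by (metis Un_subset_iff insert_subset subset_trans subsetD)
    have ef: "e \<in> N1" "f \<in> N2" "e \<in> path_image T" "f \<in> path_image T"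
      using s t T pathstart_in_path_image[of T] pathfinish_in_path_image[of T] by (simp_all add: e_def f_def)
    have "connected E"
      unfolding E_def
    proof (intro connected_Un connected_continuous_image)
      show "continuous_on {0..<s} (g i)" "continuous_on {0..<t} (h i)"
        using ag(2)[OF i] bh(2)[OF i] s t by (auto simp: path_def elim!: continuous_on_subset)
      show "g i ` {0..<s} \<inter> h i ` {0..<t} \<noteq> {}"
        using s t g0 by (metis IntI atLeastLessThan_iff empty_iff image_eqI order_refl)
    qed auto
    moreover have "x i \<in> E"
      using s g0 by (force simp: E_def)
    moreover have "N1 \<inter> path_image T = {e}" "N2 \<inter> path_image T = {f}"
      using TE EN ef N12 by auto
    moreover have "path_image T - (N1 \<union> N2) \<subseteq> E"
      using TE ef by auto
    moreover have "path_image T \<subseteq> D1 i" "E \<subseteq> D1 i - (N1 \<union> N2)"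
      using TE ED EN by auto
    ultimately have "?Q i T"
      using T(1) by blast
    then show "\<exists>T. ?Q i T" by blast
  qed
  from bchoice[OF this] obtain T where "\<forall>i\<in>I. ?Q i (T i)" ..
  then have T: "\<And>i. i \<in> I \<Longrightarrow> arc (T i)" "\<And>i. i \<in> I \<Longrightarrow> path_image (T i) \<subseteq> D1 i"
      "\<And>i. i \<in> I \<Longrightarrow> \<exists>e. N1 \<inter> path_image (T i) = {e}" "\<And>i. i \<in> I \<Longrightarrow> \<exists>f. N2 \<inter> path_image (T i) = {f}"
    and TE: "\<And>i. i \<in> I \<Longrightarrow> \<exists>E. connected E \<and> x i \<in> E \<and> E \<subseteq> D1 i - (N1 \<union> N2) \<and> path_image (T i) - (N1 \<union> N2) \<subseteq> E"
    by simp_all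
  let ?T = "\<lambda>i. path_image (T i)"
  obtain p where p: "p \<in> L3" using Lne by blast
  have NL3: "N1 \<inter> L3 = {}" "N2 \<inter> L3 = {}"
    using N1(5) M1(4) N2(5) M2(4) by blast+
  have conF: "connected (N1 \<union> N2 \<union> ?T i)" and nonsep: "connected (- (N1 \<union> N2 \<union> ?T i))" if i: "i \<in> I" for i
  proof -
    obtain e f where ef: "N1 \<inter> ?T i = {e}" "N2 \<inter> ?T i = {f}"
      using T(3,4)[OF i] by blast
    have eq: "N1 \<union> N2 \<union> ?T i = (N1 \<union> ?T i) \<union> N2" by blast
    have int: "(N1 \<union> ?T i) \<inter> N2 = {f}" using ef N12 by blast
    have "connected (N1 \<union> ?T i)"
      using N1 T(1)[OF i] ef by (intro connected_Un) (auto simp: connected_arc_image)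
    then show "connected (N1 \<union> N2 \<union> ?T i)"
      unfolding eq by (rule connected_Un) (use N2 int in auto)
    have nN1: "connected (- (N1 \<union> ?T i))"
      using N1 T(1)[OF i] ef by (intro Janiszewski_connected) (auto simp: closed_arc_image connected_arc_complement)
    show "connected (- (N1 \<union> N2 \<union> ?T i))"
      unfolding eq
      by (rule Janiszewski_connected[OF _ _ _ nN1]) (use N1 N2 T(1)[OF i] int in \<open>simp_all add: compact_Un compact_arc_image compact_imp_closed\<close>)
  qed
  \<comment> \<open>From the interior of the edge one reaches \<open>x i\<close> within
    \<open>E\<close>, then \<open>p\<close> within the connected set
    \<open>D3 i \<union> L3\<close>. All of this avoids \<open>N1\<close>, \<open>N2\<close> and the
    other two edges, so \<open>L3\<close> needs no thickening.\<close>
  have acc: "?T i - (N1 \<union> N2) \<subseteq> connected_component_set (- (N1 \<union> N2 \<union> ?T j \<union> ?T k)) p"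
    if ijk: "i \<in> I" "j \<in> I" "k \<in> I" "i \<noteq> j" "i \<noteq> k" for i j k
  proof -
    obtain E where E: "connected E" "x i \<in> E" "E \<subseteq> D1 i - (N1 \<union> N2)" "?T i - (N1 \<union> N2) \<subseteq> E"
      using TE[OF ijk(1)] by blast
    have "connected (D3 i \<union> L3)"
      using D3(1) L(6) touch(3) ijk by (intro connected_Un_touching) auto
    then have "connected (E \<union> (D3 i \<union> L3))"
      by (rule connected_Un[OF E(1)]) (use E(2) x ijk in auto)
    moreover have "E \<union> (D3 i \<union> L3) \<subseteq> - (N1 \<union> N2 \<union> ?T j \<union> ?T k)"
    proof -
      have D: "D3 i \<subseteq> D1 i" using D3(2) D2(3) ijk(1) by blast
      have T': "?T j \<inter> D1 i = {}" "?T k \<inter> D1 i = {}" "?T j \<inter> L3 = {}" "?T k \<inter> L3 = {}"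
        using T(2)[OF ijk(2)] T(2)[OF ijk(3)] disjD[OF ijk(1,2,4)] disjD[OF ijk(1,3,5)] DL[OF ijk(2)] DL[OF ijk(3)]
        by blast+
      have N': "N1 \<inter> D3 i = {}" "N2 \<inter> D3 i = {}"
        using N1D[OF ijk(1)] N2D(1)[OF ijk(1)] D3(2)[OF ijk(1)] by blast+
      have "E \<subseteq> - (N1 \<union> N2 \<union> ?T j \<union> ?T k)" using E(3) T'(1,2) by blast
      moreover have "D3 i \<subseteq> - (N1 \<union> N2 \<union> ?T j \<union> ?T k)" using D N' T'(1,2) by blast
      moreover have "L3 \<subseteq> - (N1 \<union> N2 \<union> ?T j \<union> ?T k)" using NL3 T'(3,4) by blast
      ultimately show ?thesis by simp
    qed
    ultimately have "E \<union> (D3 i \<union> L3) \<subseteq> connected_component_set (- (N1 \<union> N2 \<union> ?T j \<union> ?T k)) p"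
      using p by (intro connected_component_maximal) auto
    then show ?thesis using E(4) by blast
  qed
  obtain i j k where ijk: "I = {i, j, k}" "i \<noteq> j" "i \<noteq> k" "j \<noteq> k"
    using I by (auto simp: card_3_iff)
  have TT: "?T u \<inter> ?T v = {}" if "u \<in> I" "v \<in> I" "u \<noteq> v" for u v
    using T(2)[OF that(1)] T(2)[OF that(2)] disjD[OF that] by blast
  have pT: "p \<notin> ?T u" if "u \<in> I" for u
    using T(2)[OF that] DL[OF that] p by blast
  have mem: "i \<in> I" "j \<in> I" "k \<in> I"
    using ijk(1) by auto
  have ne: "N1 \<noteq> {}" "N2 \<noteq> {}"
    using N1(4) N2(4) neI by auto
  show False
  proof (rule no_theta_touching_three_edges)
    show "compact N1" "compact N2" by fact+
    show "compact (?T i)" "compact (?T j)" "compact (?T k)"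
      using T(1) mem by (simp_all add: compact_arc_image)
    show "connected (N1 \<union> N2 \<union> ?T i)" "connected (N1 \<union> N2 \<union> ?T j)" "connected (N1 \<union> N2 \<union> ?T k)"
      using conF mem by simp_all
    show "connected (- (N1 \<union> N2 \<union> ?T i))" "connected (- (N1 \<union> N2 \<union> ?T j))" "connected (- (N1 \<union> N2 \<union> ?T k))"
      using nonsep mem by blast+
    show "?T i \<inter> ?T j = {}" "?T i \<inter> ?T k = {}" "?T j \<inter> ?T k = {}"
      using TT mem ijk(2-4) by simp_all
    show "p \<notin> N1 \<union> N2 \<union> ?T i \<union> ?T j \<union> ?T k"
      using pT mem p NL3 by blast
    show "?T i - (N1 \<union> N2) \<subseteq> connected_component_set (- (N1 \<union> N2 \<union> ?T j \<union> ?T k)) p"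
      by (rule acc) (use mem ijk(2-4) in auto)
    show "?T j - (N1 \<union> N2) \<subseteq> connected_component_set (- (N1 \<union> N2 \<union> ?T i \<union> ?T k)) p"
      by (rule acc) (use mem ijk(2-4) in auto)
    show "?T k - (N1 \<union> N2) \<subseteq> connected_component_set (- (N1 \<union> N2 \<union> ?T i \<union> ?T j)) p"
      by (rule acc) (use mem ijk(2-4) in auto)
  qed (use N12 ne in simp_all)
qed

text \<open>A linear isomorphism onto the complex plane is a homeomorphism and carries every
  hypothesis over.\<close>

lemma planar_no_K33_euclidean:
  fixes L1 L2 L3 :: "'a::euclidean_space set" and D1 D2 D3 :: "'i \<Rightarrow> 'a set"
  assumes dim: "DIM('a) = 2" and I: "card I = 3"
    and L: "closed L1" "connected L1" "closed L2" "connected L2" "closed L3" "connected L3"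
    and disjL: "L1 \<inter> L2 = {}" "L1 \<inter> L3 = {}" "L2 \<inter> L3 = {}"
    and D1: "\<And>i. i \<in> I \<Longrightarrow> open (D1 i)" "\<And>i. i \<in> I \<Longrightarrow> connected (D1 i)"
    and D2: "\<And>i. i \<in> I \<Longrightarrow> open (D2 i)" "\<And>i. i \<in> I \<Longrightarrow> connected (D2 i)" "\<And>i. i \<in> I \<Longrightarrow> D2 i \<subseteq> D1 i"
    and D3: "\<And>i. i \<in> I \<Longrightarrow> connected (D3 i)" "\<And>i. i \<in> I \<Longrightarrow> D3 i \<subseteq> D2 i"
    and disjD: "\<And>i j. \<lbrakk>i \<in> I; j \<in> I; i \<noteq> j\<rbrakk> \<Longrightarrow> D1 i \<inter> D1 j = {}"
    and DL: "\<And>i. i \<in> I \<Longrightarrow> D1 i \<inter> (L1 \<union> L2 \<union> L3) = {}"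
    and away: "\<And>i. i \<in> I \<Longrightarrow> closure (D2 i) \<inter> L1 = {}" "\<And>i. i \<in> I \<Longrightarrow> closure (D3 i) \<inter> L2 = {}"
    and touch: "\<And>i. i \<in> I \<Longrightarrow> closure (D1 i) \<inter> L1 \<noteq> {}" "\<And>i. i \<in> I \<Longrightarrow> closure (D2 i) \<inter> L2 \<noteq> {}"
      "\<And>i. i \<in> I \<Longrightarrow> closure (D3 i) \<inter> L3 \<noteq> {}"
  shows False
proof -
  obtain f :: "'a \<Rightarrow> complex" and g where fg: "linear f" "linear g" "\<And>x. g (f x) = x" "\<And>y. f (g y) = y"
    by (rule isomorphisms_UNIV_UNIV[where 'M='a and 'N=complex]) (use dim in auto)
  have "inj f" "surj f"
    using fg by (metis injI) (metis fg(4) surjI)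
  have con: "connected (f ` S)" if "connected S" for S
    using that fg(1) by (simp add: connected_linear_image)
  have cl: "closed (f ` S)" if "closed S" for S
    using that fg(1) \<open>inj f\<close> by (simp add: closed_injective_linear_image)
  have op: "open (f ` S)" if "open S" for S
    using that fg(1) \<open>surj f\<close> by (simp add: open_surjective_linear_image)
  have clo: "closure (f ` S) = f ` closure S" for S
    using closure_injective_linear_image[OF fg(1) \<open>inj f\<close>] by simp
  note Int = image_Int[OF \<open>inj f\<close>, symmetric]
  show False
  proof (rule planar_no_K33[of I "f ` L1" "f ` L2" "f ` L3" "\<lambda>i. f ` D1 i" "\<lambda>i. f ` D2 i" "\<lambda>i. f ` D3 i"])
    show "f ` D1 i \<inter> (f ` L1 \<union> f ` L2 \<union> f ` L3) = {}" if "i \<in> I" for i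
      using DL[OF that] by (simp flip: image_Un add: Int)
  qed (use assms in \<open>simp_all add: con cl op clo Int image_mono\<close>)
qed

section \<open>Intersections of closures of clopen neighbourhoods\<close>

text \<open>For \<open>x\<close> in \<open>Y\<close> the trace on \<open>Y\<close> is the
  quasi-component of \<open>x\<close>. The closures are taken in the ambient space, so that the
  intersection is compact for bounded \<open>Y\<close>.\<close>

definition quasi_hull :: "'a::topological_space set \<Rightarrow> 'a \<Rightarrow> 'a set" where
  "quasi_hull Y x = \<Inter> {closure U | U. clopen_in Y U \<and> x \<in> U}"

lemma clopen_in_self [simp]: "clopen_in Y Y"
  by (simp add: clopen_in_def)

lemma clopen_in_subset: "clopen_in Y U \<Longrightarrow> U \<subseteq> Y"
  using openin_imp_subset by (auto simp: clopen_in_def)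

lemma clopen_in_Int: "clopen_in Y U \<Longrightarrow> clopen_in Y V \<Longrightarrow> clopen_in Y (U \<inter> V)"
  by (auto simp: clopen_in_def)

lemma clopen_in_Diff: "clopen_in Y U \<Longrightarrow> clopen_in Y V \<Longrightarrow> clopen_in Y (U - V)"
  by (auto simp: clopen_in_def openin_diff closedin_diff)

lemma clopen_in_Inter:
  assumes "finite \<U>" "\<And>U. U \<in> \<U> \<Longrightarrow> clopen_in Y U"
  shows "clopen_in Y (Y \<inter> \<Inter>\<U>)"
  using assms
proof (induction rule: finite_induct)
  case (insert U \<U>)
  have "Y \<inter> \<Inter>(insert U \<U>) = U \<inter> (Y \<inter> \<Inter>\<U>)" by auto
  with insert show ?case by (auto intro: clopen_in_Int)
qed simp

lemma clopen_in_Int_subset: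
  "clopen_in Y U \<Longrightarrow> Y' \<subseteq> Y \<Longrightarrow> clopen_in Y' (U \<inter> Y')"
  unfolding clopen_in_def
  by (metis (no_types, lifting) closedin_closed openin_open inf.absorb_iff2 inf_assoc inf_commute)

lemma clopen_in_split_by_open:
  assumes "clopen_in Y U" "open A" "open B" "A \<inter> B = {}" "U \<subseteq> A \<union> B"
  shows "clopen_in Y (U \<inter> A)"
proof -
  have U: "openin (top_of_set Y) U" "closedin (top_of_set Y) U" "U \<subseteq> Y"
    using assms(1) clopen_in_subset by (auto simp: clopen_in_def)
  have "U \<inter> A = U \<inter> (- B)" using assms by blast
  moreover have "openin (top_of_set Y) (U \<inter> A)"
    using U(1) assms(2) by (simp add: openin_Int_open)
  moreover have "closedin (top_of_set Y) (U \<inter> (- B))"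
    using U(2) assms(3) by (metis closed_Compl closedin_closed inf_assoc closed_Int)
  ultimately show ?thesis by (simp add: clopen_in_def)
qed

lemma quasi_hull_subset_closure: "clopen_in Y U \<Longrightarrow> x \<in> U \<Longrightarrow> quasi_hull Y x \<subseteq> closure U"
  by (auto simp: quasi_hull_def)

lemma self_in_quasi_hull: "x \<in> quasi_hull Y x"
  using closure_subset by (fastforce simp: quasi_hull_def)

lemma quasi_hull_mono:
  assumes "Y' \<subseteq> Y" "x \<in> Y'"
  shows "quasi_hull Y' x \<subseteq> quasi_hull Y x"
proof -
  have "quasi_hull Y' x \<subseteq> closure U" if "clopen_in Y U" "x \<in> U" for U
  proof -
    have "quasi_hull Y' x \<subseteq> closure (U \<inter> Y')"
      using that assms by (intro quasi_hull_subset_closure clopen_in_Int_subset) auto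
    also have "\<dots> \<subseteq> closure U" by (simp add: closure_mono)
    finally show ?thesis .
  qed
  then show ?thesis by (auto simp: quasi_hull_def[of Y])
qed

lemma compact_quasi_hull:
  fixes Y :: "'a::heine_borel set"
  assumes "bounded Y" "x \<in> Y"
  shows "compact (quasi_hull Y x)"
proof -
  have "closed (quasi_hull Y x)"
    by (auto simp: quasi_hull_def)
  moreover have "bounded (quasi_hull Y x)"
    using quasi_hull_subset_closure[of Y Y x] assms bounded_subset bounded_closure by auto
  ultimately show ?thesis by (simp add: compact_eq_bounded_closed)
qed

text \<open>By compactness of \<open>closure Y - G\<close>, finitely many of the closures already
  meet inside \<open>G\<close>, and a finite intersection of clopen sets is clopen.\<close>

lemma clopen_closure_in_neighbourhood_of_quasi_hull:
  fixes Y :: "'a::heine_borel set"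
  assumes "bounded Y" "x \<in> Y" "open G" "quasi_hull Y x \<subseteq> G"
  obtains U where "clopen_in Y U" "x \<in> U" "closure U \<subseteq> G"
proof -
  let ?\<V> = "{U. clopen_in Y U \<and> x \<in> U}"
  have cpt: "compact (closure Y - G)"
    using assms by (simp add: compact_diff)
  have cov: "closure Y - G \<subseteq> (\<Union>U\<in>?\<V>. - closure U)"
    using assms(4) by (auto simp: quasi_hull_def)
  obtain \<U> where \<U>: "\<U> \<subseteq> ?\<V>" "finite \<U>" "closure Y - G \<subseteq> (\<Union>U\<in>\<U>. - closure U)"
    by (rule compactE_image[OF cpt _ cov]) auto
  have "closure (Y \<inter> \<Inter>\<U>) \<subseteq> closure Y \<inter> (\<Inter>U\<in>\<U>. closure U)"
    by (auto intro: closure_mono[THEN subsetD, rotated])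
  then have "closure (Y \<inter> \<Inter>\<U>) \<subseteq> G"
    using \<U>(3) by blast
  then show ?thesis
    using that[of "Y \<inter> \<Inter>\<U>"] clopen_in_Inter[of \<U> Y] \<U> assms by auto
qed

text \<open>If the hull split between disjoint open sets, a clopen neighbourhood of \<open>x\<close>
  with closure in their union would split too. Its part around \<open>x\<close> is clopen, and the
  closure of that part misses the other open set.\<close>

lemma connected_quasi_hull:
  fixes Y :: "'a::euclidean_space set"
  assumes "bounded Y" "x \<in> Y"
  shows "connected (quasi_hull Y x)"
proof (rule ccontr)
  assume "\<not> connected (quasi_hull Y x)"
  moreover have "closed (quasi_hull Y x)"
    using assms by (simp add: compact_imp_closed compact_quasi_hull)
  ultimately obtain A B where AB: "closed A" "closed B" "A \<inter> B = {}" "A \<union> B = quasi_hull Y x" "A \<noteq> {}" "B \<noteq> {}"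
    by (metis connected_closed_set)
  then obtain G H where GH: "open G" "open H" "A \<subseteq> G" "B \<subseteq> H" "G \<inter> H = {}"
    by (meson separation_normal)
  \<comment> \<open>Stated for an arbitrary ordered pair of open sets, since \<open>x\<close> may
    lie in \<open>A\<close> or in \<open>B\<close>.\<close>
  have *: "Q = {}" if PR: "open P" "open R" "P \<inter> R = {}" "quasi_hull Y x \<subseteq> P \<union> R" "x \<in> P" "Q \<subseteq> R" "Q \<subseteq> quasi_hull Y x" for P R Q
  proof -
    obtain U where U: "clopen_in Y U" "x \<in> U" "closure U \<subseteq> P \<union> R"
      by (rule clopen_closure_in_neighbourhood_of_quasi_hull[of Y x "P \<union> R"]) (use assms PR in auto)
    then have "clopen_in Y (U \<inter> P)"
      using clopen_in_split_by_open[of Y U P R] that closure_subset[of U] by blast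
    then have "quasi_hull Y x \<subseteq> closure (U \<inter> P)"
      using U that by (intro quasi_hull_subset_closure) auto
    moreover have "R \<inter> closure (U \<inter> P) = {}"
      using that by (subst open_Int_closure_eq_empty) auto
    ultimately show ?thesis using that by blast
  qed
  have "x \<in> A \<union> B" using AB self_in_quasi_hull by metis
  then show False
    using *[of G H B] *[of H G A] AB GH by blast
qed

text \<open>A clopen subset of \<open>Y\<close> gains no point of \<open>Y\<close> on taking its
  closure, so a clopen set that separates \<open>x\<close> from \<open>z\<close> keeps
  \<open>z\<close> out of the hull.\<close>

lemma quasi_hull_Int_totally_disconnected:
  assumes "totally_disconnected Y" "x \<in> Y"
  shows "quasi_hull Y x \<inter> Y = {x}"
proof -
  have "z = x" if z: "z \<in> quasi_hull Y x" "z \<in> Y" for z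
  proof (rule ccontr)
    assume "z \<noteq> x"
    then obtain U V where UV: "clopen_in Y U" "x \<in> U" "z \<in> V" "disjnt U V"
      using assms z unfolding totally_disconnected_def by metis
    have "z \<in> closure U"
      using quasi_hull_subset_closure UV z by blast
    moreover have "Y \<inter> closure U = U"
    proof -
      obtain C where "closed C" "U = Y \<inter> C"
        using UV(1) by (auto simp: clopen_in_def closedin_closed)
      then show ?thesis
        using closure_minimal[of U C] closure_subset[of U] by blast
    qed
    ultimately show False
      using z UV by (auto simp: disjnt_def)
  qed
  then show ?thesis using self_in_quasi_hull assms by blast
qed

text \<open>If the hull were \<open>{x}\<close>, then \<open>x\<close> would have arbitrarily small
  neighbourhoods clopen in \<open>Y \<inter> B\<close> whose closures stay inside \<open>B\<close>.
  Such sets are clopen in all of \<open>Y\<close>, which makes \<open>Y\<close> zero-dimensional at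
  \<open>x\<close>.\<close>

lemma quasi_hull_nondegenerate:
  fixes Y :: "'a::heine_borel set"
  assumes "bounded Y" "x \<in> Lambda Y" "open B" "x \<in> B"
  shows "nondegenerate (quasi_hull (Y \<inter> B) x)"
proof (rule ccontr)
  assume "\<not> ?thesis"
  then have eq: "quasi_hull (Y \<inter> B) x = {x}"
    using self_in_quasi_hull[of x "Y \<inter> B"] unfolding nondegenerate_def by blast
  have xY: "x \<in> Y" using assms by (auto simp: Lambda_def)
  have "zero_dim_at Y x"
    unfolding zero_dim_at_def
  proof (intro conjI allI impI)
    fix W assume W: "openin (top_of_set Y) W \<and> x \<in> W"
    then obtain G where G: "open G" "W = Y \<inter> G"
      by (auto simp: openin_open)
    have "bounded (Y \<inter> B)" using assms bounded_Int by blast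
    then obtain U where U: "clopen_in (Y \<inter> B) U" "x \<in> U" "closure U \<subseteq> G \<inter> B"
      using clopen_closure_in_neighbourhood_of_quasi_hull[of "Y \<inter> B" x "G \<inter> B"] eq G W assms xY by auto
    have UY: "U \<subseteq> Y \<inter> B" using U clopen_in_subset by blast
    obtain O' where O': "open O'" "U = (Y \<inter> B) \<inter> O'"
      using U by (auto simp: clopen_in_def openin_open)
    obtain C where C: "closed C" "U = (Y \<inter> B) \<inter> C"
      using U by (auto simp: clopen_in_def closedin_closed)
    have "openin (top_of_set Y) U"
      using O' assms(3) by (metis Int_assoc open_Int openin_open)
    moreover have "U = Y \<inter> closure U"
      using UY U(3) C closure_minimal[of U C] closure_subset[of U] by blast
    then have "closedin (top_of_set Y) U"
      by (metis closed_closure closedin_closed)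
    ultimately show "\<exists>U. clopen_in Y U \<and> x \<in> U \<and> U \<subseteq> W"
      using U UY G closure_subset[of U] by (intro exI[of _ U]) (auto simp: clopen_in_def)
  qed (rule xY)
  then show False using assms by (auto simp: Lambda_def)
qed

text \<open>The component of \<open>x\<close> and the rest of \<open>G\<close> are both open, so the
  trace of the component on \<open>Y\<close> is again clopen. This turns contact with a hull into
  contact with a connected open set.\<close>

lemma quasi_hull_subset_closure_component:
  fixes Y :: "'a::real_normed_vector set"
  assumes "open G" "clopen_in Y (Y \<inter> G)" "x \<in> Y" "x \<in> G"
  shows "quasi_hull Y x \<subseteq> closure (connected_component_set G x)"
proof -
  let ?V = "connected_component_set G x"
  have op: "open ?V" using assms by (simp add: open_connected_component)
  have "open (G - ?V)"
  proof -
    have "G - ?V = \<Union> (connected_component_set G ` (G - ?V))"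
    proof (intro subset_antisym subsetI)
      fix y assume "y \<in> \<Union> (connected_component_set G ` (G - ?V))"
      then obtain z where "z \<in> G" "\<not> connected_component G x z" "connected_component G z y"
        by auto
      then show "y \<in> G - ?V"
        by (metis DiffI connected_component_in connected_component_sym connected_component_trans mem_Collect_eq)
    qed (auto intro: connected_component_refl)
    then show ?thesis using assms(1) open_connected_component by (metis (no_types, lifting) imageE open_Union)
  qed
  then have "clopen_in Y ((Y \<inter> G) \<inter> ?V)"
    using clopen_in_split_by_open[OF assms(2) op, of "G - ?V"] by auto
  then have "quasi_hull Y x \<subseteq> closure ((Y \<inter> G) \<inter> ?V)"
    using assms by (intro quasi_hull_subset_closure) (auto intro: connected_component_refl)
  then show ?thesis
    using closure_mono[of "(Y \<inter> G) \<inter> ?V" ?V] by auto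
qed

section \<open>Selection and separation lemmas\<close>

lemma maximal_disjoint_subfamily:
  fixes \<F> :: "'a set set"
  assumes "{} \<notin> \<F>"
  obtains \<M> where "\<M> \<subseteq> \<F>" "pairwise disjnt \<M>" "\<And>E. E \<in> \<F> \<Longrightarrow> \<exists>L\<in>\<M>. E \<inter> L \<noteq> {}"
proof -
  let ?A = "{\<M>. \<M> \<subseteq> \<F> \<and> pairwise disjnt \<M>}"
  have "\<exists>M\<in>?A. \<forall>N\<in>?A. M \<subseteq> N \<longrightarrow> N = M"
  proof (rule subset_Zorn')
    fix C assume C: "subset.chain ?A C"
    then have "pairwise disjnt (\<Union>C)"
      by (intro pairwise_chain_Union) (auto simp: subset_chain_def chain_subset_def)
    with C show "\<Union>C \<in> ?A" by (auto simp: subset_chain_def)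
  qed
  then obtain M where M: "M \<subseteq> \<F>" "pairwise disjnt M" and max: "\<And>N. N \<in> ?A \<Longrightarrow> M \<subseteq> N \<Longrightarrow> N = M"
    by auto
  have "\<exists>L\<in>M. E \<inter> L \<noteq> {}" if E: "E \<in> \<F>" for E
  proof (rule ccontr)
    assume neg: "\<not> ?thesis"
    then have "insert E M \<in> ?A"
      using M E by (auto simp: pairwise_insert disjnt_def)
    then have "E \<in> M" using max by blast
    then show False using neg assms E by (metis inf.idem)
  qed
  with M show ?thesis using that by blast
qed

lemma totally_disconnected_separate_finite:
  assumes "totally_disconnected Y" "finite A" "A \<subseteq> Y"
  obtains U where "\<And>x. x \<in> A \<Longrightarrow> clopen_in Y (U x)" "\<And>x. x \<in> A \<Longrightarrow> x \<in> U x"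
    "\<And>x y. \<lbrakk>x \<in> A; y \<in> A; x \<noteq> y\<rbrakk> \<Longrightarrow> U x \<inter> U y = {}"
proof -
  have "\<exists>W. clopen_in Y W \<and> x \<in> W \<and> y \<notin> W" if "x \<in> A" "y \<in> A" "x \<noteq> y" for x y
    using assms that unfolding totally_disconnected_def disjnt_def by (metis disjoint_iff subsetD)
  then obtain W where W: "\<And>x y. \<lbrakk>x \<in> A; y \<in> A; x \<noteq> y\<rbrakk> \<Longrightarrow> clopen_in Y (W x y) \<and> x \<in> W x y \<and> y \<notin> W x y"
    by metis
  \<comment> \<open>Subtracting \<open>W y x\<close> makes the sets disjoint: \<open>U x\<close>
    lies outside \<open>W y x\<close>, while \<open>U y\<close> lies inside it.\<close>
  define U where "U x = Y \<inter> \<Inter> ((\<lambda>y. W x y - W y x) ` (A - {x}))" for x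
  show ?thesis
  proof
    show "clopen_in Y (U x)" if "x \<in> A" for x
      unfolding U_def using W that assms(2) by (intro clopen_in_Inter) (auto intro!: clopen_in_Diff)
    show "x \<in> U x" if "x \<in> A" for x
      using W that assms(3) by (auto simp: U_def)
    show "U x \<inter> U y = {}" if "x \<in> A" "y \<in> A" "x \<noteq> y" for x y
      using that by (auto simp: U_def)
  qed
qed

lemma disjoint_openin_extend:
  fixes Y :: "'a::metric_space set"
  assumes U: "\<And>i. i \<in> I \<Longrightarrow> openin (top_of_set Y) (U i)" "\<And>i. i \<in> I \<Longrightarrow> U i \<noteq> {}"
    and disj: "\<And>i j. \<lbrakk>i \<in> I; j \<in> I; i \<noteq> j\<rbrakk> \<Longrightarrow> U i \<inter> U j = {}"
    and two: "\<And>i. i \<in> I \<Longrightarrow> \<exists>j\<in>I. j \<noteq> i"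
  obtains G where "\<And>i. i \<in> I \<Longrightarrow> open (G i)" "\<And>i. i \<in> I \<Longrightarrow> Y \<inter> G i = U i"
    "\<And>i j. \<lbrakk>i \<in> I; j \<in> I; i \<noteq> j\<rbrakk> \<Longrightarrow> G i \<inter> G j = {}"
proof -
  \<comment> \<open>Points nearer to \<open>U i\<close> than to the rest of \<open>Y\<close>. As
    \<open>infdist\<close> to the empty set is 0, \<open>G i\<close> would be empty if
    \<open>U i\<close> were all of \<open>Y\<close>; the assumption \<open>two\<close> rules this
    out.\<close>
  define G where "G i = {p. infdist p (U i) < infdist p (Y - U i)}" for i
  have sub: "U i \<subseteq> Y" if "i \<in> I" for i
    using U(1)[OF that] openin_imp_subset by blast
  have far: "U j \<subseteq> Y - U i" if "i \<in> I" "j \<in> I" "i \<noteq> j" for i j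
    using sub[of j] disj[of i j] that by blast
  have le: "infdist p (Y - U i) \<le> infdist p (U j)" if "i \<in> I" "j \<in> I" "i \<noteq> j" for i j p
    using far[OF that] U(2)[of j] that by (intro infdist_mono) auto
  show ?thesis
  proof
    show "open (G i)" for i
      unfolding G_def by (intro open_Collect_less continuous_intros)
    show "G i \<inter> G j = {}" if "i \<in> I" "j \<in> I" "i \<noteq> j" for i j
    proof -
      have False if "p \<in> G i" "p \<in> G j" for p
        using that le[of i j p] le[of j i p] \<open>i \<in> I\<close> \<open>j \<in> I\<close> \<open>i \<noteq> j\<close> by (simp add: G_def)
      then show ?thesis by blast
    qed
    show "Y \<inter> G i = U i" if i: "i \<in> I" for i
    proof (intro subset_antisym subsetI)
      fix y assume y: "y \<in> Y \<inter> G i"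
      show "y \<in> U i"
      proof (rule ccontr)
        assume "y \<notin> U i"
        then have "infdist y (Y - U i) = 0" using y by (simp add: infdist_zero)
        then show False using y infdist_nonneg[of y "U i"] by (simp add: G_def)
      qed
    next
      fix y assume y: "y \<in> U i"
      obtain j where "j \<in> I" "j \<noteq> i" using two i by blast
      then have ne: "Y - U i \<noteq> {}" using far[of i j] U(2)[of j] i by blast
      obtain V where V: "open V" "U i = Y \<inter> V"
        using U(1)[OF i] by (auto simp: openin_open)
      then have "closure (Y - U i) \<subseteq> - V"
        by (intro closure_minimal) auto
      then have "y \<notin> closure (Y - U i)" using y V by blast
      then have "infdist y (Y - U i) > 0"
        using ne in_closure_iff_infdist_zero[of "Y - U i" y] infdist_nonneg[of y "Y - U i"] by linarith
      then show "y \<in> Y \<inter> G i"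
        using y sub[OF i] by (auto simp: G_def infdist_zero)
    qed
  qed
qed

lemma closure_avoiding_basic_neighbourhood:
  fixes L :: "'a::metric_space set"
  assumes "topological_basis \<B>" "closed L" "x \<notin> L"
  shows "\<exists>B\<in>\<B>. x \<in> B \<and> closure B \<inter> L = {}"
proof -
  obtain e where e: "e > 0" "cball x e \<subseteq> - L"
    using assms(2,3) open_contains_cball[of "- L"] by (auto simp: open_Compl)
  obtain B where B: "B \<in> \<B>" "x \<in> B" "B \<subseteq> ball x e"
    using topological_basisE[OF assms(1), of "ball x e" x] e by auto
  have "closure B \<subseteq> cball x e"
    using B by (intro closure_minimal) (auto simp: less_imp_le)
  then show ?thesis using B e by blast
qed

lemma uncountable_fibre_of_size:
  assumes "uncountable P" "countable (f ` P)"
  obtains A c where "A \<subseteq> P" "finite A" "card A = n" "\<And>x. x \<in> A \<Longrightarrow> f x = c"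
proof -
  have "\<exists>c. infinite {x \<in> P. f x = c}"
  proof (rule ccontr)
    assume "\<not> ?thesis"
    then have "countable (\<Union>c\<in>f ` P. {x \<in> P. f x = c})"
      using assms(2) by (intro countable_UN) (auto intro: countable_finite)
    moreover have "(\<Union>c\<in>f ` P. {x \<in> P. f x = c}) = P" by auto
    ultimately show False using assms(1) by simp
  qed
  then obtain c where "infinite {x \<in> P. f x = c}" ..
  from infinite_arbitrarily_large[OF this, of n]
  obtain A where "finite A" "card A = n" "A \<subseteq> {x \<in> P. f x = c}"
    by blast
  then show ?thesis using that[of A c] by blast
qed

section \<open>Countability of the non-zero-dimensional points\<close>

theorem countable_Lambda_planar_suslinian:
  fixes X Y :: "'a::euclidean_space set"
  assumes dim: "DIM('a) = 2" and X: "compact X" "suslinian X"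
    and Y: "Y \<subseteq> X" "totally_disconnected Y"
  shows "countable (Lambda Y)"
proof (rule ccontr)
  assume unc: "uncountable (Lambda Y)"
  have bY: "bounded Y" using X Y bounded_subset compact_imp_bounded by blast
  have LY: "Lambda Y \<subseteq> Y" by (auto simp: Lambda_def)
  have hullX: "quasi_hull Y x \<subseteq> X" if "x \<in> Y" for x
    using quasi_hull_subset_closure[of Y Y x] closure_minimal[of Y X] X Y that compact_imp_closed by auto
  define \<F> where "\<F> = {E. continuum E \<and> nondegenerate E \<and> (\<exists>x\<in>Lambda Y. E \<subseteq> quasi_hull Y x)}"
  have "{} \<notin> \<F>" by (auto simp: \<F>_def continuum_def)
  then obtain \<M> where \<M>: "\<M> \<subseteq> \<F>" "pairwise disjnt \<M>" "\<And>E. E \<in> \<F> \<Longrightarrow> \<exists>L\<in>\<M>. E \<inter> L \<noteq> {}"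
    using maximal_disjoint_subfamily by metis
  have "\<forall>C\<in>\<M>. C \<subseteq> X \<and> continuum C \<and> nondegenerate C"
    using \<M>(1) hullX LY by (fastforce simp: \<F>_def)
  then have cM: "countable \<M>"
    using X(2)[unfolded suslinian_def, rule_format, of \<M>] \<M>(2) by simp
  have finYL: "finite (Y \<inter> L)" if L: "L \<in> \<M>" for L
  proof -
    obtain x where "x \<in> Lambda Y" "L \<subseteq> quasi_hull Y x"
      using L \<M>(1) by (auto simp: \<F>_def)
    then have "Y \<inter> L \<subseteq> {x}"
      using quasi_hull_Int_totally_disconnected[OF Y(2), of x] LY by blast
    then show ?thesis using finite_subset by blast
  qed
  have clL: "closed L" "connected L" if "L \<in> \<M>" for L
    using that \<M>(1) by (auto simp: \<F>_def continuum_def compact_imp_closed)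
  \<comment> \<open>Each member of \<open>\<M>\<close> lies in one hull and so holds at most one
    point of \<open>Y\<close>. Only countably many points are discarded, and each remaining point
    has a neighbourhood whose closure misses any given member.\<close>
  define P where "P = Lambda Y - (\<Union>L\<in>\<M>. Y \<inter> L)"
  have "countable (\<Union>L\<in>\<M>. Y \<inter> L)"
    using cM finYL by (intro countable_UN) (auto intro: countable_finite)
  then have uncP: "uncountable P"
    unfolding P_def using unc by (rule uncountable_minus_countable[rotated])
  have PY: "x \<in> Y" "x \<in> Lambda Y" "\<And>L. L \<in> \<M> \<Longrightarrow> x \<notin> L" if "x \<in> P" for x
    using that LY by (auto simp: P_def)
  have meets: "\<exists>L\<in>\<M>. quasi_hull (Y \<inter> B) x \<inter> L \<noteq> {}" if "x \<in> P" "open B" "x \<in> B" for x B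
  proof (rule \<M>(3))
    have b: "bounded (Y \<inter> B)" and xB: "x \<in> Y \<inter> B"
      using bY bounded_Int PY that by auto
    have "quasi_hull (Y \<inter> B) x \<subseteq> quasi_hull Y x"
      using xB by (intro quasi_hull_mono) auto
    then show "quasi_hull (Y \<inter> B) x \<in> \<F>"
      using compact_quasi_hull[OF b xB] connected_quasi_hull[OF b xB] self_in_quasi_hull[of x "Y \<inter> B"]
        quasi_hull_nondegenerate[OF bY, of x B] PY that
      by (auto simp: \<F>_def continuum_def)
  qed
  obtain \<B> :: "'a set set" where \<B>: "countable \<B>" "topological_basis \<B>"
    using ex_countable_basis by blast
  have opB: "open B" if "B \<in> \<B>" for B
    using \<B>(2) that topological_basis_open by blast
  \<comment> \<open>The tuple \<open>t\<close> is a code for \<open>x\<close>; using basic open sets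
    keeps the set of codes countable. Localising the third hull to \<open>B2 \<inter> B3\<close>
    makes the three levels nested.\<close>
  define good where "good x t = (case t of (L1, B2, L2, B3, L3) \<Rightarrow>
      L1 \<in> \<M> \<and> L2 \<in> \<M> \<and> L3 \<in> \<M> \<and> B2 \<in> \<B> \<and> B3 \<in> \<B> \<and> x \<in> B2 \<and> x \<in> B3 \<and>
      closure B2 \<inter> L1 = {} \<and> closure B3 \<inter> L2 = {} \<and> quasi_hull Y x \<inter> L1 \<noteq> {} \<and>
      quasi_hull (Y \<inter> B2) x \<inter> L2 \<noteq> {} \<and> quasi_hull (Y \<inter> (B2 \<inter> B3)) x \<inter> L3 \<noteq> {})" for x t
  have "\<exists>t. good x t" if x: "x \<in> P" for x
  proof -
    obtain L1 where L1: "L1 \<in> \<M>" "quasi_hull Y x \<inter> L1 \<noteq> {}"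
      using meets[OF x, of UNIV] by auto
    obtain B2 where B2: "B2 \<in> \<B>" "x \<in> B2" "closure B2 \<inter> L1 = {}"
      using closure_avoiding_basic_neighbourhood[OF \<B>(2) clL(1)] L1 PY(3)[OF x] by metis
    obtain L2 where L2: "L2 \<in> \<M>" "quasi_hull (Y \<inter> B2) x \<inter> L2 \<noteq> {}"
      using meets[OF x, of B2] B2 opB by auto
    obtain B3 where B3: "B3 \<in> \<B>" "x \<in> B3" "closure B3 \<inter> L2 = {}"
      using closure_avoiding_basic_neighbourhood[OF \<B>(2) clL(1)] L2 PY(3)[OF x] by metis
    obtain L3 where L3: "L3 \<in> \<M>" "quasi_hull (Y \<inter> (B2 \<inter> B3)) x \<inter> L3 \<noteq> {}"
      using meets[OF x, of "B2 \<inter> B3"] B2 B3 opB open_Int[of B2 B3] by auto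
    show ?thesis
      using L1 B2 L2 B3 L3 by (intro exI[of _ "(L1, B2, L2, B3, L3)"]) (simp add: good_def)
  qed
  then obtain t where t: "\<And>x. x \<in> P \<Longrightarrow> good x (t x)" by metis
  have "t ` P \<subseteq> \<M> \<times> \<B> \<times> \<M> \<times> \<B> \<times> \<M>"
    using t by (fastforce simp: good_def)
  then have "countable (t ` P)"
    using cM \<B>(1) by (meson countable_SIGMA countable_subset)
  then obtain A c where A: "A \<subseteq> P" "finite A" "card A = 3" "\<And>x. x \<in> A \<Longrightarrow> t x = c"
    using uncountable_fibre_of_size[OF uncP] by metis
  obtain L1 B2 L2 B3 L3 where c: "c = (L1, B2, L2, B3, L3)" by (cases c)
  have g: "good x (L1, B2, L2, B3, L3)" if "x \<in> A" for x
    using t A c that by (metis subsetD)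
  have AP: "x \<in> P" if "x \<in> A" for x using A that by blast
  obtain x0 where x0: "x0 \<in> A" using A by fastforce
  have LM: "L1 \<in> \<M>" "L2 \<in> \<M>" "L3 \<in> \<M>" and oB: "open B2" "open B3"
    and clB: "closure B2 \<inter> L1 = {}" "closure B3 \<inter> L2 = {}"
    using g[OF x0] opB by (auto simp: good_def)
  have hull_sub: "quasi_hull (Y \<inter> B) x \<subseteq> closure B" if "x \<in> Y \<inter> B" for x B
    using quasi_hull_subset_closure[OF clopen_in_self that] closure_mono[of "Y \<inter> B" B] by auto
  \<comment> \<open>\<open>L2\<close> and \<open>L3\<close> meet \<open>closure B2\<close> but
    \<open>L1\<close> does not; \<open>L3\<close> meets \<open>closure B3\<close> but
    \<open>L2\<close> does not. So the three are distinct members of a disjoint family.\<close>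
  have "closure B2 \<inter> L2 \<noteq> {}" "closure (B2 \<inter> B3) \<inter> L3 \<noteq> {}"
    using g[OF x0] hull_sub[of x0 B2] hull_sub[of x0 "B2 \<inter> B3"] PY(1)[OF AP[OF x0]] by (auto simp: good_def)
  moreover have "closure (B2 \<inter> B3) \<subseteq> closure B2 \<inter> closure B3"
    by (simp add: closure_mono)
  ultimately have "L1 \<noteq> L2" "L1 \<noteq> L3" "L2 \<noteq> L3" using clB by blast+
  then have disjL: "L1 \<inter> L2 = {}" "L1 \<inter> L3 = {}" "L2 \<inter> L3 = {}"
    using \<M>(2) LM by (auto simp: pairwise_def disjnt_def)
  define \<L> where "\<L> = L1 \<union> L2 \<union> L3"
  \<comment> \<open>The finitely many points of \<open>Y\<close> on \<open>\<L>\<close> are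
    separated along with those of \<open>A\<close>. Then each \<open>U x\<close> misses
    \<open>\<L>\<close>, and removing \<open>\<L>\<close> from \<open>G0 x\<close> leaves its trace
    on \<open>Y\<close> unchanged.\<close>
  have "finite (A \<union> Y \<inter> \<L>)"
    using A finYL LM by (auto simp: \<L>_def Int_Un_distrib)
  moreover have "A \<union> Y \<inter> \<L> \<subseteq> Y" using A(1) PY(1) by blast
  ultimately obtain U where U: "\<And>x. x \<in> A \<union> Y \<inter> \<L> \<Longrightarrow> clopen_in Y (U x)" "\<And>x. x \<in> A \<union> Y \<inter> \<L> \<Longrightarrow> x \<in> U x"
    "\<And>x y. \<lbrakk>x \<in> A \<union> Y \<inter> \<L>; y \<in> A \<union> Y \<inter> \<L>; x \<noteq> y\<rbrakk> \<Longrightarrow> U x \<inter> U y = {}"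
    by (rule totally_disconnected_separate_finite[OF Y(2)]) blast
  have AL: "x \<notin> \<L>" if "x \<in> A" for x
    using PY(3)[OF AP[OF that]] LM by (auto simp: \<L>_def)
  have UL: "U x \<inter> \<L> = {}" if "x \<in> A" for x
  proof -
    have "U x \<subseteq> Y" using U(1) that clopen_in_subset by blast
    moreover have False if "y \<in> U x" "y \<in> Y \<inter> \<L>" for y
      using U(2)[of y] U(3)[of x y] AL[OF \<open>x \<in> A\<close>] \<open>x \<in> A\<close> that by blast
    ultimately show ?thesis by blast
  qed
  have two: "\<exists>y\<in>A. y \<noteq> x" if "x \<in> A" for x
  proof (rule ccontr)
    assume "\<not> ?thesis"
    then have "A = {x}" using that by blast
    then show False using A by simp
  qed
  obtain G0 where G0: "\<And>x. x \<in> A \<Longrightarrow> open (G0 x)" "\<And>x. x \<in> A \<Longrightarrow> Y \<inter> G0 x = U x"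
    "\<And>x y. \<lbrakk>x \<in> A; y \<in> A; x \<noteq> y\<rbrakk> \<Longrightarrow> G0 x \<inter> G0 y = {}"
  proof (rule disjoint_openin_extend[of A Y U])
    show "openin (top_of_set Y) (U i)" if "i \<in> A" for i
      using U(1) that by (auto simp: clopen_in_def)
    show "U i \<noteq> {}" if "i \<in> A" for i
      using U(2)[of i] that by blast
    show "U i \<inter> U j = {}" if "i \<in> A" "j \<in> A" "i \<noteq> j" for i j
      using U(3) that by blast
    show "\<exists>j\<in>A. j \<noteq> i" if "i \<in> A" for i
      using that by (rule two)
  qed blast
  define G where "G x = G0 x - \<L>" for x
  have G: "open (G x)" "Y \<inter> G x = U x" "x \<in> G x" "x \<in> Y" if "x \<in> A" for x
  proof -
    have "closed \<L>" using clL LM by (auto simp: \<L>_def)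
    then show "open (G x)" using G0 that by (simp add: G_def open_Diff)
    show "Y \<inter> G x = U x" using G0(2)[OF that] UL[OF that] by (auto simp: G_def)
    then show "x \<in> G x" using U(2)[of x] that by blast
    show "x \<in> Y" by (rule PY(1)[OF AP[OF that]])
  qed
  \<comment> \<open>The open set \<open>G x \<inter> B\<close> has on \<open>Y \<inter> B\<close>
    the trace \<open>U x \<inter> (Y \<inter> B)\<close>, which is clopen there, so the hull of
    \<open>x\<close> in \<open>Y \<inter> B\<close> lies in \<open>closure (D B x)\<close>.\<close>
  define D where "D B x = connected_component_set (G x \<inter> B) x" for B x
  have Dtouch: "quasi_hull (Y \<inter> B) x \<subseteq> closure (D B x)" if "x \<in> A" "open B" "x \<in> B" for B x
    unfolding D_def
  proof (rule quasi_hull_subset_closure_component)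
    have "Y \<inter> B \<inter> (G x \<inter> B) = U x \<inter> (Y \<inter> B)"
      using G(2)[OF that(1)] by blast
    then show "clopen_in (Y \<inter> B) (Y \<inter> B \<inter> (G x \<inter> B))"
      using clopen_in_Int_subset[OF U(1)[of x], of "Y \<inter> B"] that by simp
  qed (use G that in auto)
  have Dsub: "D B x \<subseteq> G x \<inter> B" for B x
    unfolding D_def by (rule connected_component_subset)
  have Dop: "open (D B x)" if "x \<in> A" "open B" for B x
    unfolding D_def using G that by (simp add: open_Int open_connected_component)
  have Dmono: "D B x \<subseteq> D C x" if "B \<subseteq> C" for B C x
    unfolding D_def using that by (intro connected_component_mono) auto
  have inB: "x \<in> B2" "x \<in> B3" if "x \<in> A" for x
    using g[OF that] by (auto simp: good_def)
  show False
  proof (rule planar_no_K33_euclidean[OF dim A(3), of L1 L2 L3 "D UNIV" "D B2" "D (B2 \<inter> B3)"])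
    fix x assume x: "x \<in> A"
    show "D UNIV x \<inter> (L1 \<union> L2 \<union> L3) = {}"
      using Dsub[of UNIV x] by (auto simp: G_def \<L>_def)
    show "closure (D B2 x) \<inter> L1 = {}"
      using Dsub[of B2 x] clB(1) closure_mono[of "D B2 x" B2] by blast
    show "closure (D (B2 \<inter> B3) x) \<inter> L2 = {}"
      using Dsub[of "B2 \<inter> B3" x] clB(2) closure_mono[of "D (B2 \<inter> B3) x" B3] by blast
    show "closure (D UNIV x) \<inter> L1 \<noteq> {}"
      using Dtouch[OF x, of UNIV] g[OF x] by (auto simp: good_def)
    show "closure (D B2 x) \<inter> L2 \<noteq> {}"
      using Dtouch[OF x oB(1)] inB[OF x] g[OF x] by (auto simp: good_def)
    show "closure (D (B2 \<inter> B3) x) \<inter> L3 \<noteq> {}"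
      using Dtouch[OF x open_Int[OF oB]] inB[OF x] g[OF x] by (auto simp: good_def)
    show "connected (D UNIV x)" "connected (D B2 x)" "connected (D (B2 \<inter> B3) x)"
      by (simp_all add: D_def)
    show "D B2 x \<subseteq> D UNIV x" "D (B2 \<inter> B3) x \<subseteq> D B2 x"
      by (simp_all add: Dmono)
    show "open (D UNIV x)" "open (D B2 x)"
      using Dop x oB by auto
    fix y assume "y \<in> A" "x \<noteq> y"
    then show "D UNIV x \<inter> D UNIV y = {}"
      using Dsub[of UNIV x] Dsub[of UNIV y] G0(3)[of x y] x by (auto simp: G_def)
  qed (simp_all add: clL LM disjL)
qed

theorem theorem3:
  fixes X Y :: "(real^2) set"
  assumes "continuum X" and "locally connected X" and "suslinian X"
    and "Y \<subseteq> X" and "totally_disconnected Y" and "Y \<in> sets borel"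
  shows "countable (Lambda Y)"
proof (rule countable_Lambda_planar_suslinian)
  show "DIM(real^2) = 2" by simp
  show "compact X" using assms(1) by (simp add: continuum_def)
qed (fact assms)+

end
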